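(* Let $X$ be an asymptotically uniformly convex (AUC) Banach space such that $\delta_X(t)=t$ holds for all $t\geq0$. Then every infinite subset of $X$ has the LTP. In particular, for every infinite subset $M$ of $X$, the Lipschitz-free space $\mathcal F(M)$ has an octahedral norm.
   Context: All Banach spaces are real; $S_X$ is the unit sphere of $X$. The modulus of asymptotic uniform convexity of $X$ is $$\delta_X(t)=\inf_{x\in S_X}\ \sup_{\mathrm{codim}(Y)<\infty}\ \inf_{y\in S_Y}\|x+ty\|-1,$$ where the supremum is over closed finite-codimensional subspaces $Y$ of $X$ (with the convention $\inf\emptyset=+\infty$). $X$ is AUC if $\delta_X(t)>0$ for every $t>0$. A metric space $(M,d)$ has the long trapezoid property (LTP) if for each finite subset $N\subseteq M$ and each $\varepsilon>0$ there exist $u,v\in M$, $u\neq v$, such that $(1-\varepsilon)(d(x,y)+d(u,v))\leq d(x,u)+d(y,v)$ holds for all $x,y\in N$. Subsets of $X$ carry the metric induced by the norm. For a metric space $M$ with a distinguished point $0$ (any chosen point of $M$), $\mathrm{Lip}_0(M)$ is the Banach space of all real Lipschitz functions on $M$ vanishing at the distinguished point, with norm $\|f\|=\sup\{|f(x)-f(y)|/d(x,y): x\neq y\}$; $\delta_m\in\mathrm{Lip}_0(M)^*$ is $\delta_m(f)=f(m)$, and $\mathcal F(M)=\overline{\mathrm{span}}\{\delta_m:m\in M\}\subseteq\mathrm{Lip}_0(M)^*$ with the dual norm. The norm of a Banach space $Z$ is octahedral if for every finite-dimensional subspace $F\subseteq Z$ and every $\varepsilon>0$ there exists $z\in S_Z$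 such that $\|y+\lambda z\|\geq(1-\varepsilon)(\|y\|+|\lambda|)$ for every $y\in F$ and every $\lambda\in\mathbb R$. *)

theory Defs
  imports "HOL-Analysis.Analysis" "HOL-Library.Function_Algebras"
begin

definition finite_codim :: "'a::real_vector set \<Rightarrow> bool" where
  "finite_codim Y \<longleftrightarrow> subspace Y \<and> (\<exists>B. finite B \<and> span (Y \<union> B) = UNIV)"

text \<open>The values are extended reals, where the infimum of the empty set is \<open>\<infinity>\<close> and
  \<open>\<infinity> - 1 = \<infinity>\<close>; in particular the modulus is \<open>\<infinity>\<close> on finite-dimensional spaces.\<close>

definition auc_modulus :: "'a::real_normed_vector itself \<Rightarrow> real \<Rightarrow> ereal" where
  "auc_modulus _ t =
     (INF x \<in> sphere (0::'a) 1.
        SUP Y \<in> {Y. closed Y \<and> finite_codim Y}.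
          INF y \<in> Y \<inter> sphere 0 1. ereal (norm (x + t *\<^sub>R y))) - 1"

definition AUC :: "'a::real_normed_vector itself \<Rightarrow> bool" where
  "AUC X \<longleftrightarrow> (\<forall>t>0. auc_modulus X t > 0)"

definition long_trapezoid_property :: "'a::metric_space set \<Rightarrow> bool" where
  "long_trapezoid_property M \<longleftrightarrow>
     (\<forall>N \<epsilon>. finite N \<and> N \<subseteq> M \<and> \<epsilon> > 0 \<longrightarrow>
        (\<exists>u\<in>M. \<exists>v\<in>M. u \<noteq> v \<and>
          (\<forall>x\<in>N. \<forall>y\<in>N. (1 - \<epsilon>) * (dist x y + dist u v) \<le> dist x u + dist y v)))"

instantiation "fun" :: (type, real_vector) real_vector
begin

definition scaleR_fun :: "real \<Rightarrow> ('a \<Rightarrow> 'b) \<Rightarrow> 'a \<Rightarrow> 'b" where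
  "scaleR_fun c f = (\<lambda>x. c *\<^sub>R f x)"

instance
  by standard (simp_all add: scaleR_fun_def fun_eq_iff algebra_simps)

end

text \<open>Functions on a set \<open>M\<close> are represented by functions on the whole type that vanish
  outside \<open>M\<close>, so that equality of representatives is equality on \<open>M\<close>. The same convention
  is used below for functionals on \<open>Lip0 M p\<close>. The point \<open>p\<close> is the distinguished point.\<close>

definition Lip0 :: "'a::metric_space set \<Rightarrow> 'a \<Rightarrow> ('a \<Rightarrow> real) set" where
  "Lip0 M p = {f. (\<exists>L. L-lipschitz_on M f) \<and> f p = 0 \<and> (\<forall>x. x \<notin> M \<longrightarrow> f x = 0)}"

text \<open>Inserting \<open>0\<close> only matters for one-point sets, where there are no difference quotients.\<close>

definition lip_norm :: "'a::metric_space set \<Rightarrow> ('a \<Rightarrow> real) \<Rightarrow> real" where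
  "lip_norm M f = Sup (insert 0 {\<bar>f x - f y\<bar> / dist x y | x y. x \<in> M \<and> y \<in> M \<and> x \<noteq> y})"

definition Lip0_dual :: "'a::metric_space set \<Rightarrow> 'a \<Rightarrow> (('a \<Rightarrow> real) \<Rightarrow> real) set" where
  "Lip0_dual M p = {\<phi>.
     (\<forall>f\<in>Lip0 M p. \<forall>g\<in>Lip0 M p. \<phi> (f + g) = \<phi> f + \<phi> g) \<and>
     (\<forall>c. \<forall>f\<in>Lip0 M p. \<phi> (c *\<^sub>R f) = c * \<phi> f) \<and>
     (\<exists>C. \<forall>f\<in>Lip0 M p. \<bar>\<phi> f\<bar> \<le> C * lip_norm M f) \<and>
     (\<forall>f. f \<notin> Lip0 M p \<longrightarrow> \<phi> f = 0)}"

definition dual_norm :: "'a::metric_space set \<Rightarrow> 'a \<Rightarrow> (('a \<Rightarrow> real) \<Rightarrow> real) \<Rightarrow> real" where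
  "dual_norm M p \<phi> = Sup {\<bar>\<phi> f\<bar> | f. f \<in> Lip0 M p \<and> lip_norm M f \<le> 1}"

definition point_eval :: "'a::metric_space set \<Rightarrow> 'a \<Rightarrow> 'a \<Rightarrow> ('a \<Rightarrow> real) \<Rightarrow> real" where
  "point_eval M p m = (\<lambda>f. if f \<in> Lip0 M p then f m else 0)"

definition free_space :: "'a::metric_space set \<Rightarrow> 'a \<Rightarrow> (('a \<Rightarrow> real) \<Rightarrow> real) set" where
  "free_space M p = {\<phi> \<in> Lip0_dual M p.
     \<forall>e>0. \<exists>\<psi> \<in> span (point_eval M p ` M). dual_norm M p (\<phi> - \<psi>) < e}"

text \<open>\<open>Z\<close> is a linear subspace of an ambient real vector space and \<open>nrm\<close> restricts to a norm on \<open>Z\<close>.\<close>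

definition octahedral :: "'v::real_vector set \<Rightarrow> ('v \<Rightarrow> real) \<Rightarrow> bool" where
  "octahedral Z nrm \<longleftrightarrow>
     (\<forall>F \<epsilon>. subspace F \<and> (\<exists>B. finite B \<and> F = span B) \<and> F \<subseteq> Z \<and> \<epsilon> > 0 \<longrightarrow>
        (\<exists>z\<in>Z. nrm z = 1 \<and>
          (\<forall>y\<in>F. \<forall>c. nrm (y + c *\<^sub>R z) \<ge> (1 - \<epsilon>) * (nrm y + \<bar>c\<bar>))))"

end

theory Submission
  imports Defs
begin

text \<open>In a set that is unbounded or not uniformly discrete, a far away point or a pair of very
  close points verifies the long trapezoid property. In a bounded uniformly discrete infinite set,
  the modulus provides for each pair \<open>x \<noteq> y\<close> in \<open>N\<close> a finite-codimensional \<open>Y\<close> on which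
  \<open>\<parallel>x - y - w\<parallel>\<close> is almost \<open>\<parallel>x - y\<parallel> + \<parallel>w\<parallel>\<close>; by total boundedness modulo \<open>Y\<close> there are distinct
  \<open>u, v\<close> whose difference is almost in all these \<open>Y\<close>, and
  \<open>\<parallel>x - u\<parallel> + \<parallel>y - v\<parallel> \<ge> \<parallel>x - y - (u - v)\<parallel>\<close>.

  For octahedrality, elements of a finite-dimensional subspace are approximated by combinations of
  evaluations at a finite set \<open>N\<close>. With \<open>u, v\<close> from the long trapezoid property for \<open>N\<close>, a function
  norming such a combination, multiplied by \<open>1 - \<epsilon>\<close>, extends from \<open>N\<close> to a \<open>1\<close>-Lipschitz function
  whose increment from \<open>v\<close> to \<open>u\<close> is at least \<open>(1 - \<epsilon>) d(u, v)\<close>, so \<open>(\<delta>\<^sub>u - \<delta>\<^sub>v) / d(u, v)\<close>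
  is almost \<open>\<ell>\<^sub>1\<close>-orthogonal to the subspace.\<close>

section \<open>Infinite subsets have the long trapezoid property\<close>

text \<open>The modulus at the single value \<open>T / norm a\<close> suffices for all shorter
  \<open>w\<close>: lowering the coefficient of a unit vector from \<open>t\<close> to
  \<open>s\<close> lowers the norm by at most \<open>t - s\<close>, which is exactly the decrease in
  the wanted bound. Rescaling by \<open>norm a\<close> turns the error \<open>d\<close> into
  \<open>e\<close>.\<close>

lemma auc_modulus_eq_imp_subspace:
  fixes a :: "'a::real_normed_vector"
  assumes modulus: "\<And>t. t \<ge> 0 \<Longrightarrow> auc_modulus TYPE('a) t = ereal t"
    and "a \<noteq> 0" "T \<ge> 0" "e > 0"
  obtains Y where "finite_codim Y"
    "\<And>w. w \<in> Y \<Longrightarrow> norm w \<le> T \<Longrightarrow> norm (a - w) \<ge> norm a + norm w - e"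
proof -
  define x where "x = a /\<^sub>R norm a"
  define t where "t = T / norm a"
  define d where "d = e / norm a"
  have na: "norm a > 0" using assms by simp
  have d: "d > 0" using na assms by (simp add: d_def)
  have t: "t \<ge> 0" using assms by (simp add: t_def)
  have x: "x \<in> sphere 0 1" using na by (simp add: x_def)
  let ?S = "\<lambda>x::'a. SUP Y \<in> {Y. closed Y \<and> finite_codim Y}.
          INF y \<in> Y \<inter> sphere 0 1. ereal (norm (x + t *\<^sub>R y))"
  have "(INF x \<in> sphere 0 1. ?S x) - 1 = ereal t"
    using modulus[OF t] by (simp add: auc_modulus_def)
  \<comment> \<open>The cancellation of \<open>- 1\<close> takes place in the extended reals; an
    infinite infimum is excluded because the difference is the real number \<open>t\<close>.\<close>
  then have "(INF x \<in> sphere 0 1. ?S x) = ereal (1 + t)"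
    by (cases "INF x \<in> sphere 0 1. ?S x") (auto simp: one_ereal_def)
  then have "ereal (1 + t) \<le> ?S x"
    using x by (metis (no_types, lifting) INF_lower)
  moreover have "ereal (1 + t - d) < ereal (1 + t)" using d by simp
  ultimately have "ereal (1 + t - d) < ?S x" by (rule less_le_trans[rotated])
  then obtain Y where Y: "finite_codim Y"
    and inf: "ereal (1 + t - d) < (INF y \<in> Y \<inter> sphere 0 1. ereal (norm (x + t *\<^sub>R y)))"
    by (auto simp: less_SUP_iff)
  have low: "norm (x + t *\<^sub>R y) \<ge> 1 + t - d" if "y \<in> Y" "norm y = 1" for y
  proof -
    have "ereal (1 + t - d) < ereal (norm (x + t *\<^sub>R y))"
      using inf by (rule less_INF_D) (use that in simp)
    then show ?thesis by simp
  qed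
  have "norm (a - w) \<ge> norm a + norm w - e" if w: "w \<in> Y" "norm w \<le> T" for w
  proof (cases "w = 0")
    case False
    \<comment> \<open>The modulus speaks of \<open>x + t *\<^sub>R y\<close> and the claim of
      \<open>a - w\<close>, hence the sign. With this choice \<open>a - w\<close> is
      \<open>norm a\<close> times \<open>x + s *\<^sub>R y\<close>.\<close>
    define y where "y = - (w /\<^sub>R norm w)"
    define s where "s = norm w / norm a"
    have "subspace Y" using Y by (simp add: finite_codim_def)
    then have y: "y \<in> Y" "norm y = 1"
      using w False unfolding y_def by (auto intro: subspace_neg subspace_scale)
    have st: "s \<le> t" using w na by (simp add: s_def t_def divide_right_mono)
    have "1 + t - d \<le> norm ((x + s *\<^sub>R y) + (t - s) *\<^sub>R y)"
      using low[OF y] by (simp add: algebra_simps)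
    also have "\<dots> \<le> norm (x + s *\<^sub>R y) + (t - s)"
      using norm_triangle_ineq[of "x + s *\<^sub>R y" "(t - s) *\<^sub>R y"] y st by simp
    finally have "1 + s - d \<le> norm (x + s *\<^sub>R y)" by simp
    then have "norm a * (1 + s - d) \<le> norm (norm a *\<^sub>R (x + s *\<^sub>R y))"
      using na by simp
    moreover have "norm a *\<^sub>R (x + s *\<^sub>R y) = a - w"
      using na False by (simp add: x_def y_def s_def algebra_simps)
    moreover have "norm a * (1 + s - d) = norm a + norm w - e"
      using na by (simp add: s_def d_def field_simps)
    ultimately show ?thesis by simp
  qed (use \<open>e > 0\<close> in simp)
  with Y show thesis by (rule that)
qed

section \<open>Total boundedness modulo finite-codimensional subspaces\<close>

text \<open>This is total boundedness of balls in a finite-dimensional quotient, stated without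
  forming the quotient. The induction adds one vector \<open>b\<close> at a time. The radius and the
  tolerance vary, since both are adjusted before the induction hypothesis is applied.\<close>

lemma bounded_finite_net_modulo_subspace:
  fixes Y :: "'a::real_normed_vector set"
  assumes "finite B" "subspace Y" "\<eta> > 0"
  shows "\<exists>K. finite K \<and>
    (\<forall>z\<in>span (Y \<union> B). norm z \<le> R \<longrightarrow> (\<exists>k\<in>K. \<exists>w\<in>Y. norm (z - k - w) < \<eta>))"
  using assms(1,3)
proof (induction B arbitrary: R \<eta> rule: finite_induct)
  case empty
  have "\<exists>k\<in>{0}. \<exists>w\<in>Y. norm (z - k - w) < \<eta>" if "z \<in> span (Y \<union> {})" for z
    using that \<open>subspace Y\<close> empty
    by (intro bexI[of _ 0] bexI[of _ z]) (simp_all add: span_eq_iff[THEN iffD2])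
  then show ?case by blast
next
  case (insert b B)
  let ?Z = "span (Y \<union> B)"
  have decomp: "\<exists>c. z - c *\<^sub>R b \<in> ?Z" if "z \<in> span (Y \<union> insert b B)" for z
    using that by (simp add: span_breakdown_eq)
  have half: "\<eta> / 2 > 0" using insert by simp
  show ?case
  \<comment> \<open>The distance from \<open>b\<close> to \<open>?Z\<close> may be zero even if
    \<open>b\<close> lies outside \<open>?Z\<close>. In that case \<open>b\<close> contributes
    nothing up to a small error; otherwise its coefficient is bounded in terms of
    \<open>norm z\<close>.\<close>
  proof (cases "\<forall>d>0. \<exists>z\<in>?Z. norm (b - z) < d")
    case True
    obtain K where K: "finite K" "\<And>z. z \<in> ?Z \<Longrightarrow> norm z \<le> R + \<eta> / 2 \<Longrightarrow>
        \<exists>k\<in>K. \<exists>w\<in>Y. norm (z - k - w) < \<eta> / 2"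
      using insert.IH[OF half, of "R + \<eta> / 2"] by blast
    have "\<exists>k\<in>K. \<exists>w\<in>Y. norm (z - k - w) < \<eta>"
      if z: "z \<in> span (Y \<union> insert b B)" "norm z \<le> R" for z
    proof -
      obtain c where c: "z - c *\<^sub>R b \<in> ?Z" using decomp z by blast
      \<comment> \<open>No bound on \<open>c\<close> is available here, so the approximation
        \<open>z0\<close> of \<open>b\<close> is chosen after \<open>c\<close>. The summand
        \<open>1\<close> covers \<open>c = 0\<close>.\<close>
      have "\<eta> / (2 * (\<bar>c\<bar> + 1)) > 0" using half by simp
      then obtain z0 where z0: "z0 \<in> ?Z" "norm (b - z0) < \<eta> / (2 * (\<bar>c\<bar> + 1))"
        using True by meson
      define z' where "z' = (z - c *\<^sub>R b) + c *\<^sub>R z0"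
      have z': "z' \<in> ?Z" unfolding z'_def using c z0 by (intro span_add span_scale)
      have "z - z' = c *\<^sub>R (b - z0)" by (simp add: z'_def algebra_simps)
      then have "norm (z - z') = \<bar>c\<bar> * norm (b - z0)" by simp
      also have "\<dots> \<le> (\<bar>c\<bar> + 1) * norm (b - z0)" by (simp add: mult_right_mono)
      also have "\<dots> < \<eta> / 2" using z0(2) by (simp add: field_simps)
      finally have dz: "norm (z - z') < \<eta> / 2" .
      have "norm z' \<le> norm z + norm (z - z')"
        using norm_triangle_ineq4[of z "z - z'"] by simp
      with z dz have "norm z' \<le> R + \<eta> / 2" by simp
      then obtain k w where kw: "k \<in> K" "w \<in> Y" "norm (z' - k - w) < \<eta> / 2"
        using K(2)[OF z'] by blast
      have "norm (z - k - w) \<le> norm (z' - k - w) + norm (z - z')"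
        using norm_triangle_ineq[of "z' - k - w" "z - z'"] by (simp add: algebra_simps)
      with kw dz show ?thesis by force
    qed
    with K show ?thesis by blast
  next
    case False
    then obtain d where d: "d > 0" "\<And>z. z \<in> ?Z \<Longrightarrow> norm (b - z) \<ge> d"
      by (meson not_less)
    \<comment> \<open>\<open>T\<close> bounds the coefficient of \<open>b\<close> in vectors of norm
      at most \<open>R\<close>, as such a vector has norm at least \<open>\<bar>c\<bar> * d\<close>.
      The mesh \<open>\<theta>\<close> is such that rounding the coefficient to a point of
      \<open>J\<close> moves the vector by at most \<open>\<eta> / 2\<close>.\<close>
    define T where "T = R / d"
    define \<theta> where "\<theta> = \<eta> / (2 * (norm b + 1))"
    have nb: "norm b + 1 > 0" by (smt (verit) norm_ge_zero)
    have \<theta>: "\<theta> > 0" using half nb by (simp add: \<theta>_def)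
    obtain J where J: "finite J" "{-T..T} \<subseteq> (\<Union>j\<in>J. ball j \<theta>)"
      using compact_Icc[of "-T" T] \<theta> unfolding compact_eq_totally_bounded by meson
    obtain K where K: "finite K" "\<And>z. z \<in> ?Z \<Longrightarrow> norm z \<le> R + T * norm b \<Longrightarrow>
        \<exists>k\<in>K. \<exists>w\<in>Y. norm (z - k - w) < \<eta> / 2"
      using insert.IH[OF half, of "R + T * norm b"] by blast
    let ?K = "(\<lambda>(k, j). k + j *\<^sub>R b) ` (K \<times> J)"
    have "\<exists>k\<in>?K. \<exists>w\<in>Y. norm (z - k - w) < \<eta>"
      if z: "z \<in> span (Y \<union> insert b B)" "norm z \<le> R" for z
    proof -
      obtain c where c: "z - c *\<^sub>R b \<in> ?Z" using decomp z by blast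
      have "\<bar>c\<bar> * d \<le> norm z"
      proof (cases "c = 0")
        case False
        have "(- inverse c) *\<^sub>R (z - c *\<^sub>R b) \<in> ?Z" using c by (rule span_scale)
        then have "d \<le> norm (b - (- inverse c) *\<^sub>R (z - c *\<^sub>R b))" by (rule d)
        also have "b - (- inverse c) *\<^sub>R (z - c *\<^sub>R b) = inverse c *\<^sub>R z"
          using False by (simp add: algebra_simps)
        also have "norm \<dots> = norm z / \<bar>c\<bar>" using False by (simp add: field_simps)
        finally show ?thesis using False by (simp add: field_simps)
      qed simp
      then have cT: "\<bar>c\<bar> \<le> T" using d(1) z by (simp add: T_def field_simps)
      then obtain j where j: "j \<in> J" "\<bar>c - j\<bar> < \<theta>"
      proof -
        have "c \<in> {-T..T}" using cT by auto
        then obtain j where "j \<in> J" "c \<in> ball j \<theta>" using J(2) by blast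
        then show thesis using that[of j] by (simp add: dist_real_def abs_minus_commute)
      qed
      have "norm (z - c *\<^sub>R b) \<le> norm z + \<bar>c\<bar> * norm b"
        using norm_triangle_ineq4[of z "c *\<^sub>R b"] by simp
      also have "\<dots> \<le> R + T * norm b" using z cT by (intro add_mono mult_right_mono) auto
      finally obtain k w where kw: "k \<in> K" "w \<in> Y" "norm (z - c *\<^sub>R b - k - w) < \<eta> / 2"
        using K(2)[OF c] by blast
      have "norm ((c - j) *\<^sub>R b) \<le> \<theta> * (norm b + 1)"
        using j(2) \<theta> by (auto intro!: mult_mono)
      also have "\<dots> = \<eta> / 2" using nb by (simp add: \<theta>_def field_simps)
      finally have "norm ((c - j) *\<^sub>R b) \<le> \<eta> / 2" .
      moreover have "z - (k + j *\<^sub>R b) - w = (z - c *\<^sub>R b - k - w) + (c - j) *\<^sub>R b"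
        by (simp add: algebra_simps)
      ultimately have "norm (z - (k + j *\<^sub>R b) - w) < \<eta>"
        using kw(3) norm_triangle_ineq[of "z - c *\<^sub>R b - k - w" "(c - j) *\<^sub>R b"]
        by (simp only:)
      then show ?thesis using kw j by force
    qed
    moreover have "finite ?K" using K J by simp
    ultimately show ?thesis by blast
  qed
qed

text \<open>Treat the subspaces one after another. By the pigeonhole principle infinitely many of
  the remaining points share a net point modulo \<open>Y a\<close>; subtracting two of them cancels
  it and leaves a vector within \<open>\<eta>\<close> of \<open>Y a\<close>. Passing to a subset
  keeps what was achieved for earlier indices.\<close>

lemma infinite_bounded_differences_near_finite_codim:
  fixes M :: "'a::real_normed_vector set"
  assumes "finite D" "\<And>a. a \<in> D \<Longrightarrow> finite_codim (Y a)" "infinite M" "bounded M" "\<eta> > 0"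
  shows "\<exists>M'\<subseteq>M. infinite M' \<and> (\<forall>a\<in>D. \<forall>u\<in>M'. \<forall>v\<in>M'. \<exists>w\<in>Y a. norm (u - v - w) < \<eta>)"
  using assms(1,2)
proof (induction D rule: finite_induct)
  case empty
  then show ?case using assms by blast
next
  case (insert a D)
  then obtain M' where M': "M' \<subseteq> M" "infinite M'"
    "\<And>a u v. a \<in> D \<Longrightarrow> u \<in> M' \<Longrightarrow> v \<in> M' \<Longrightarrow> \<exists>w\<in>Y a. norm (u - v - w) < \<eta>"
    by (metis insertCI)
  obtain R where R: "\<And>z. z \<in> M \<Longrightarrow> norm z \<le> R"
    using \<open>bounded M\<close> unfolding bounded_iff by blast
  obtain B where B: "finite B" "subspace (Y a)" "span (Y a \<union> B) = UNIV"
    using insert.prems[of a] unfolding finite_codim_def by blast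
  have "\<eta> / 2 > 0" using \<open>\<eta> > 0\<close> by simp
  then obtain K where K: "finite K"
    "\<And>z. norm z \<le> R \<Longrightarrow> \<exists>k\<in>K. \<exists>w\<in>Y a. norm (z - k - w) < \<eta> / 2"
    using bounded_finite_net_modulo_subspace[OF B(1,2), of "\<eta> / 2" R] B(3) by auto
  have "\<forall>z\<in>M'. \<exists>k\<in>K. \<exists>w\<in>Y a. norm (z - k - w) < \<eta> / 2"
    using K(2) R M'(1) by blast
  then obtain \<kappa> where \<kappa>: "\<And>z. z \<in> M' \<Longrightarrow> \<kappa> z \<in> K \<and> (\<exists>w\<in>Y a. norm (z - \<kappa> z - w) < \<eta> / 2)"
    by metis
  have "finite (\<kappa> ` M')" using K(1) \<kappa> by (meson finite_subset image_subsetI)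
  from pigeonhole_infinite[OF M'(2) this]
  obtain z0 where "z0 \<in> M'" and inf: "infinite {z \<in> M'. \<kappa> z = \<kappa> z0}" by blast
  let ?M = "{z \<in> M'. \<kappa> z = \<kappa> z0}"
  have "\<exists>w\<in>Y a. norm (u - v - w) < \<eta>" if uv: "u \<in> ?M" "v \<in> ?M" for u v
  proof -
    obtain w1 where w1: "w1 \<in> Y a" "norm (u - \<kappa> z0 - w1) < \<eta> / 2"
      using \<kappa>[of u] uv by auto
    obtain w2 where w2: "w2 \<in> Y a" "norm (v - \<kappa> z0 - w2) < \<eta> / 2"
      using \<kappa>[of v] uv by auto
    have "u - v - (w1 - w2) = (u - \<kappa> z0 - w1) - (v - \<kappa> z0 - w2)" by simp
    then have "norm (u - v - (w1 - w2)) < \<eta>"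
      using norm_triangle_ineq4[of "u - \<kappa> z0 - w1" "v - \<kappa> z0 - w2"] w1(2) w2(2)
      by (simp only:)
    then show ?thesis using subspace_diff[OF B(2) w1(1) w2(1)] by blast
  qed
  then show ?case using M' inf by (intro exI[of _ ?M]) auto
qed

section \<open>Long trapezoids in infinite sets\<close>

text \<open>The diagonal case is split off because the arguments for close pairs and for the modulus
  rely on \<open>x\<close> and \<open>y\<close> being distinct.\<close>

lemma long_trapezoid_inequality_self:
  fixes x :: "'a::metric_space"
  assumes "\<epsilon> > 0"
  shows "(1 - \<epsilon>) * (dist x x + dist u v) \<le> dist x u + dist x v"
proof -
  have "(1 - \<epsilon>) * dist u v \<le> 1 * dist u v" using assms by (intro mult_right_mono) auto
  also have "\<dots> \<le> dist x u + dist x v" by (metis dist_commute dist_triangle mult_1)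
  finally show ?thesis by simp
qed

lemma long_trapezoid_property_unbounded:
  fixes M :: "'a::metric_space set"
  assumes "\<not> bounded M"
  shows "long_trapezoid_property M"
  unfolding long_trapezoid_property_def
proof (intro allI impI, elim conjE)
  fix N :: "'a set" and \<epsilon> :: real
  assume N: "finite N" "N \<subseteq> M" and \<epsilon>: "\<epsilon> > 0"
  obtain u where u: "u \<in> M" using assms by fastforce
  have "bounded (insert u N)" using N by (simp add: finite_imp_bounded)
  then obtain C where C: "C \<ge> 0" "\<And>x y. x \<in> insert u N \<Longrightarrow> y \<in> insert u N \<Longrightarrow> dist x y \<le> C"
    by (metis bounded_two_points order_trans zero_le_dist insertI1)
  \<comment> \<open>The term \<open>2 * C / \<epsilon>\<close> makes
    \<open>\<epsilon> * dist u v\<close> at least \<open>2 * C\<close>, which pays once for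
    \<open>dist x y\<close> and once for \<open>dist u y\<close>.\<close>
  obtain v where v: "v \<in> M" "dist u v > 2 * C / \<epsilon> + C"
    using assms unfolding bounded_any_center[where a = u] by (meson not_less)
  have pos: "dist u v > C" using v(2) C \<epsilon> by (smt (verit) divide_nonneg_pos)
  have "(1 - \<epsilon>) * (dist x y + dist u v) \<le> dist x u + dist y v" if "x \<in> N" "y \<in> N" for x y
  proof -
    have "dist u v \<le> dist u y + dist y v" by (rule dist_triangle)
    moreover have "dist u y \<le> C" "dist x y \<le> C" using C that by auto
    moreover have "2 * C \<le> \<epsilon> * dist u v"
    proof -
      have "2 * C / \<epsilon> \<le> dist u v" using v(2) C(1) by linarith
      then show ?thesis using \<epsilon> by (simp add: field_simps)
    qed
    moreover have "0 \<le> \<epsilon> * dist x y" "0 \<le> dist x u" using \<epsilon> by auto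
    moreover have "(1 - \<epsilon>) * (dist x y + dist u v)
        = dist x y + dist u v - \<epsilon> * dist x y - \<epsilon> * dist u v"
      by (simp add: algebra_simps)
    ultimately show ?thesis by linarith
  qed
  moreover have "u \<noteq> v" using pos C by auto
  ultimately show "\<exists>u\<in>M. \<exists>v\<in>M. u \<noteq> v \<and>
      (\<forall>x\<in>N. \<forall>y\<in>N. (1 - \<epsilon>) * (dist x y + dist u v) \<le> dist x u + dist y v)"
    using u v by blast
qed

lemma long_trapezoid_property_not_uniformly_discrete:
  fixes M :: "'a::metric_space set"
  assumes close: "\<And>r. r > 0 \<Longrightarrow> \<exists>u\<in>M. \<exists>v\<in>M. u \<noteq> v \<and> dist u v < r"
  shows "long_trapezoid_property M"
  unfolding long_trapezoid_property_def
proof (intro allI impI, elim conjE)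
  fix N :: "'a set" and \<epsilon> :: real
  assume N: "finite N" "N \<subseteq> M" and \<epsilon>: "\<epsilon> > 0"
  obtain d where d: "d > 0" "\<And>x y. x \<in> N \<Longrightarrow> y \<in> N \<Longrightarrow> x \<noteq> y \<Longrightarrow> d \<le> dist x y"
  proof -
    have "\<forall>x\<in>N. \<exists>d>0. \<forall>y\<in>N. y \<noteq> x \<longrightarrow> d \<le> dist x y"
      using finite_set_avoid[OF N(1)] by blast
    then obtain D where D: "\<And>x. x \<in> N \<Longrightarrow> D x > 0"
      "\<And>x y. x \<in> N \<Longrightarrow> y \<in> N \<Longrightarrow> y \<noteq> x \<Longrightarrow> D x \<le> dist x y" by metis
    have "\<exists>d>0. \<forall>x\<in>N. d \<le> D x"
    proof (cases "N = {}")
      case False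
      then show ?thesis using N(1) D(1) by (intro exI[of _ "Min (D ` N)"]) auto
    qed (auto intro: exI[of _ 1])
    then show thesis using D(2) that by (metis order_trans)
  qed
  \<comment> \<open>By the triangle inequality the trapezoid loses at most
    \<open>2 * dist u v\<close>. This is less than \<open>\<epsilon> * d\<close>, hence less than
    \<open>\<epsilon> * dist x y\<close> for distinct points of \<open>N\<close>.\<close>
  obtain u v where uv: "u \<in> M" "v \<in> M" "u \<noteq> v" "dist u v < \<epsilon> * d / 2"
    using close[of "\<epsilon> * d / 2"] d \<epsilon> by auto
  have "(1 - \<epsilon>) * (dist x y + dist u v) \<le> dist x u + dist y v"
    if xy: "x \<in> N" "y \<in> N" for x y
  proof (cases "x = y")
    case True
    then show ?thesis using long_trapezoid_inequality_self[OF \<epsilon>] by simp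
  next
    case False
    have "dist x y \<le> dist x u + dist u v + dist y v"
      using dist_triangle[of x y u] dist_triangle[of u y v] by (simp add: dist_commute)
    moreover have "\<epsilon> * d \<le> \<epsilon> * dist x y" using d xy False \<epsilon> by simp
    moreover have "0 \<le> \<epsilon> * dist u v" using \<epsilon> by simp
    ultimately show ?thesis using uv(4) by (simp add: algebra_simps)
  qed
  then show "\<exists>u\<in>M. \<exists>v\<in>M. u \<noteq> v \<and>
      (\<forall>x\<in>N. \<forall>y\<in>N. (1 - \<epsilon>) * (dist x y + dist u v) \<le> dist x u + dist y v)"
    using uv by blast
qed

lemma long_trapezoid_property_of_modulus:
  fixes M :: "'a::real_normed_vector set"
  assumes modulus: "\<And>t. t \<ge> 0 \<Longrightarrow> auc_modulus TYPE('a) t = ereal t" and "infinite M"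
  shows "long_trapezoid_property M"
proof (cases "bounded M \<and> (\<exists>r>0. \<forall>u\<in>M. \<forall>v\<in>M. u \<noteq> v \<longrightarrow> r \<le> dist u v)")
  case False
  then show ?thesis
    using long_trapezoid_property_unbounded long_trapezoid_property_not_uniformly_discrete
    by (metis not_le)
next
  case True
  then obtain r where bdd: "bounded M" and r: "r > 0"
    "\<And>u v. u \<in> M \<Longrightarrow> v \<in> M \<Longrightarrow> u \<noteq> v \<Longrightarrow> r \<le> dist u v" by blast
  obtain R where R: "R \<ge> 0" "\<And>u v. u \<in> M \<Longrightarrow> v \<in> M \<Longrightarrow> dist u v \<le> R"
    using bdd by (metis bounded_two_points dual_order.trans linear)
  show ?thesis
    unfolding long_trapezoid_property_def
  proof (intro allI impI, elim conjE)
    fix N :: "'a set" and \<epsilon> :: real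
    assume N: "finite N" "N \<subseteq> M" and \<epsilon>: "\<epsilon> > 0"
    \<comment> \<open>Three errors of size \<open>\<eta>\<close> arise: one from the modulus and two
      from exchanging \<open>u - v\<close> with a vector \<open>w\<close> of the subspace. Together
      they are at most \<open>\<epsilon> * r\<close>, and uniform discreteness gives
      \<open>r \<le> norm (u - v)\<close>.\<close>
    define \<eta> where "\<eta> = \<epsilon> * r / 3"
    define D where "D = (\<lambda>(x, y). x - y) ` (N \<times> N) - {0}"
    have \<eta>: "\<eta> > 0" using \<epsilon> r by (simp add: \<eta>_def)
    \<comment> \<open>The subspaces are fixed before \<open>u\<close> and \<open>v\<close> are
      known. The bound \<open>R + \<eta>\<close> covers every \<open>w\<close> that lies within
      \<open>\<eta>\<close> of a difference of two points of \<open>M\<close>.\<close>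
    have "\<forall>a\<in>D. \<exists>Y. finite_codim Y \<and>
        (\<forall>w\<in>Y. norm w \<le> R + \<eta> \<longrightarrow> norm (a - w) \<ge> norm a + norm w - \<eta>)"
    proof
      fix a assume "a \<in> D"
      then have "a \<noteq> 0" by (simp add: D_def)
      show "\<exists>Y. finite_codim Y \<and>
        (\<forall>w\<in>Y. norm w \<le> R + \<eta> \<longrightarrow> norm (a - w) \<ge> norm a + norm w - \<eta>)"
        using auc_modulus_eq_imp_subspace[OF modulus \<open>a \<noteq> 0\<close>, of "R + \<eta>" \<eta>] R(1) \<eta>
        by (metis add_nonneg_nonneg less_imp_le)
    qed
    then obtain Y where Y: "\<And>a. a \<in> D \<Longrightarrow> finite_codim (Y a)"
      "\<And>a w. a \<in> D \<Longrightarrow> w \<in> Y a \<Longrightarrow> norm w \<le> R + \<eta> \<Longrightarrow> norm (a - w) \<ge> norm a + norm w - \<eta>"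
      by metis
    have "finite D" using N by (simp add: D_def)
    then obtain M' where M': "M' \<subseteq> M" "infinite M'"
      "\<And>a u v. a \<in> D \<Longrightarrow> u \<in> M' \<Longrightarrow> v \<in> M' \<Longrightarrow> \<exists>w\<in>Y a. norm (u - v - w) < \<eta>"
      using infinite_bounded_differences_near_finite_codim[of D Y M \<eta>] Y(1) \<open>infinite M\<close> bdd \<eta>
      by blast
    obtain u where u: "u \<in> M'" using M'(2) by fastforce
    obtain v where v: "v \<in> M'" "u \<noteq> v"
      using M'(2) by (metis finite.simps insertI1 subsetI subset_singletonD)
    have ruv: "r \<le> norm (u - v)" "norm (u - v) \<le> R"
      using r(2)[of u v] R(2)[of u v] u v M'(1) by (auto simp: dist_norm)
    have "(1 - \<epsilon>) * (dist x y + dist u v) \<le> dist x u + dist y v"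
      if xy: "x \<in> N" "y \<in> N" for x y
    proof (cases "x = y")
      case True
      then show ?thesis using long_trapezoid_inequality_self[OF \<epsilon>] by simp
    next
      case False
      then have a: "x - y \<in> D" using xy by (force simp: D_def)
      then obtain w where w: "w \<in> Y (x - y)" "norm (u - v - w) < \<eta>"
        using M'(3)[OF a u v(1)] by blast
      have tri: "norm w \<le> norm (u - v) + norm (u - v - w)" "norm (u - v) \<le> norm w + norm (u - v - w)"
        using norm_triangle_ineq4[of "u - v" "u - v - w"] norm_triangle_ineq[of w "u - v - w"]
        by auto
      then have "norm (x - y - w) \<ge> norm (x - y) + norm w - \<eta>"
        using Y(2)[OF a w(1)] w(2) ruv by simp
      moreover have "norm (x - y - w) \<le> norm (x - u) + norm (y - v) + norm (u - v - w)"
      proof -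
        have "x - y - w = ((x - u) - (y - v)) + (u - v - w)" by simp
        then show ?thesis
          using norm_triangle_ineq[of "(x - u) - (y - v)" "u - v - w"]
            norm_triangle_ineq4[of "x - u" "y - v"] by simp
      qed
      ultimately have "norm (x - y) + norm (u - v) - 3 * \<eta> \<le> norm (x - u) + norm (y - v)"
        using tri w(2) by linarith
      moreover have "3 * \<eta> \<le> \<epsilon> * norm (u - v)" using ruv \<epsilon> by (simp add: \<eta>_def)
      moreover have "0 \<le> \<epsilon> * norm (x - y)" using \<epsilon> by simp
      ultimately show ?thesis by (simp add: dist_norm algebra_simps)
    qed
    then show "\<exists>u\<in>M. \<exists>v\<in>M. u \<noteq> v \<and>
      (\<forall>x\<in>N. \<forall>y\<in>N. (1 - \<epsilon>) * (dist x y + dist u v) \<le> dist x u + dist y v)"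
      using u v M'(1) by blast
  qed
qed

section \<open>Lipschitz functions and their dual\<close>

lemma Lip0_vanish: "f \<in> Lip0 M p \<Longrightarrow> f p = 0"
  by (simp add: Lip0_def)

lemma subspace_Lip0: "subspace (Lip0 M p)"
proof (rule subspaceI)
  show "0 \<in> Lip0 M p"
    unfolding Lip0_def using lipschitz_on_constant[of M "0::real"] by (auto simp: zero_fun_def)
next
  fix f g assume f: "f \<in> Lip0 M p" and g: "g \<in> Lip0 M p"
  then obtain L K where "L-lipschitz_on M f" "K-lipschitz_on M g"
    by (auto simp: Lip0_def)
  then have "(L + K)-lipschitz_on M (f + g)"
    using lipschitz_on_add[of L M f K g] by (simp add: plus_fun_def)
  with f g show "f + g \<in> Lip0 M p" by (auto simp: Lip0_def)
next
  fix c :: real and f assume f: "f \<in> Lip0 M p"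
  then obtain L where "L-lipschitz_on M f" by (auto simp: Lip0_def)
  then have "(\<bar>c\<bar> * L)-lipschitz_on M (c *\<^sub>R f)"
    using lipschitz_on_cmult_real[of L M f c] by (simp add: scaleR_fun_def)
  with f show "c *\<^sub>R f \<in> Lip0 M p" by (auto simp: Lip0_def scaleR_fun_def)
qed

lemma lip_norm_le:
  assumes "\<And>x y. x \<in> M \<Longrightarrow> y \<in> M \<Longrightarrow> \<bar>f x - f y\<bar> \<le> L * dist x y" "L \<ge> 0"
  shows "lip_norm M f \<le> L"
  unfolding lip_norm_def
proof (rule cSup_least)
  fix q assume "q \<in> insert 0 {\<bar>f x - f y\<bar> / dist x y | x y. x \<in> M \<and> y \<in> M \<and> x \<noteq> y}"
  then show "q \<le> L"
    using assms by (auto simp: field_simps)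
qed simp

lemma bdd_above_lip_quotients:
  assumes "f \<in> Lip0 M p"
  shows "bdd_above (insert 0 {\<bar>f x - f y\<bar> / dist x y | x y. x \<in> M \<and> y \<in> M \<and> x \<noteq> y})"
proof -
  obtain L where "L-lipschitz_on M f" using assms by (auto simp: Lip0_def)
  then have "\<bar>f x - f y\<bar> / dist x y \<le> L" if "x \<in> M" "y \<in> M" "x \<noteq> y" for x y
    using lipschitz_onD[of L M f x y] that by (simp add: dist_real_def field_simps)
  then show ?thesis unfolding bdd_above_insert by (intro bdd_aboveI) blast
qed

lemma lip_norm_nonneg: "f \<in> Lip0 M p \<Longrightarrow> 0 \<le> lip_norm M f"
  unfolding lip_norm_def by (rule cSup_upper[OF insertI1 bdd_above_lip_quotients])

lemma lip_norm_bound: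
  assumes "f \<in> Lip0 M p" "x \<in> M" "y \<in> M"
  shows "\<bar>f x - f y\<bar> \<le> lip_norm M f * dist x y"
proof (cases "x = y")
  case False
  have "\<bar>f x - f y\<bar> / dist x y \<le> lip_norm M f"
    unfolding lip_norm_def
    by (rule cSup_upper) (use assms False bdd_above_lip_quotients in auto)
  then show ?thesis using False by (simp add: field_simps)
qed simp

lemma lip_norm_scaleR_le:
  assumes "f \<in> Lip0 M p"
  shows "lip_norm M (c *\<^sub>R f) \<le> \<bar>c\<bar> * lip_norm M f"
proof (rule lip_norm_le)
  fix x y assume "x \<in> M" "y \<in> M"
  then have "\<bar>c\<bar> * \<bar>f x - f y\<bar> \<le> \<bar>c\<bar> * (lip_norm M f * dist x y)"
    by (intro mult_left_mono lip_norm_bound[OF assms]) auto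
  then show "\<bar>(c *\<^sub>R f) x - (c *\<^sub>R f) y\<bar> \<le> \<bar>c\<bar> * lip_norm M f * dist x y"
    by (simp add: scaleR_fun_def mult.assoc flip: abs_mult right_diff_distrib)
qed (simp add: lip_norm_nonneg[OF assms])

section \<open>Bounded functionals on Lipschitz functions and the dual norm\<close>

lemma Lip0_dual_bounded:
  assumes "\<phi> \<in> Lip0_dual M p"
  obtains C where "\<And>f. f \<in> Lip0 M p \<Longrightarrow> \<bar>\<phi> f\<bar> \<le> C * lip_norm M f"
  using assms unfolding Lip0_dual_def by blast

lemma Lip0_dual_scaleR: "\<phi> \<in> Lip0_dual M p \<Longrightarrow> f \<in> Lip0 M p \<Longrightarrow> \<phi> (c *\<^sub>R f) = c * \<phi> f"
  by (simp add: Lip0_dual_def)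

lemma Lip0_dual_diff:
  assumes "\<phi> \<in> Lip0_dual M p" "f \<in> Lip0 M p" "g \<in> Lip0 M p"
  shows "\<phi> (f - g) = \<phi> f - \<phi> g"
proof -
  have "(-1) *\<^sub>R g \<in> Lip0 M p" using assms subspace_Lip0 by (blast intro: subspace_scale)
  then have "\<phi> (f + (-1) *\<^sub>R g) = \<phi> f + \<phi> ((-1) *\<^sub>R g)"
    using assms unfolding Lip0_dual_def by blast
  then show ?thesis using assms Lip0_dual_scaleR[of \<phi> M p g "-1"] by simp
qed

lemma subspace_Lip0_dual: "subspace (Lip0_dual M p)"
proof (rule subspaceI)
  show "0 \<in> Lip0_dual M p" by (auto simp: Lip0_dual_def intro: exI[of _ 0])
next
  fix \<phi> \<psi> assume \<phi>: "\<phi> \<in> Lip0_dual M p" and \<psi>: "\<psi> \<in> Lip0_dual M p"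
  obtain C where C: "\<And>f. f \<in> Lip0 M p \<Longrightarrow> \<bar>\<phi> f\<bar> \<le> C * lip_norm M f"
    using Lip0_dual_bounded[OF \<phi>] by blast
  obtain D where D: "\<And>f. f \<in> Lip0 M p \<Longrightarrow> \<bar>\<psi> f\<bar> \<le> D * lip_norm M f"
    using Lip0_dual_bounded[OF \<psi>] by blast
  have "\<bar>(\<phi> + \<psi>) f\<bar> \<le> (C + D) * lip_norm M f" if "f \<in> Lip0 M p" for f
    using C[OF that] D[OF that] by (simp add: algebra_simps)
  then have "\<exists>C. \<forall>f\<in>Lip0 M p. \<bar>(\<phi> + \<psi>) f\<bar> \<le> C * lip_norm M f" by blast
  with \<phi> \<psi> show "\<phi> + \<psi> \<in> Lip0_dual M p" by (simp add: Lip0_dual_def algebra_simps)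
next
  fix c :: real and \<phi> assume \<phi>: "\<phi> \<in> Lip0_dual M p"
  obtain C where C: "\<And>f. f \<in> Lip0 M p \<Longrightarrow> \<bar>\<phi> f\<bar> \<le> C * lip_norm M f"
    using Lip0_dual_bounded[OF \<phi>] by blast
  have "\<bar>(c *\<^sub>R \<phi>) f\<bar> \<le> (\<bar>c\<bar> * C) * lip_norm M f" if "f \<in> Lip0 M p" for f
    using mult_left_mono[OF C[OF that], of "\<bar>c\<bar>"]
    by (simp add: scaleR_fun_def abs_mult mult.assoc)
  then have "\<exists>C. \<forall>f\<in>Lip0 M p. \<bar>(c *\<^sub>R \<phi>) f\<bar> \<le> C * lip_norm M f" by blast
  with \<phi> show "c *\<^sub>R \<phi> \<in> Lip0_dual M p"
    by (simp add: Lip0_dual_def scaleR_fun_def algebra_simps)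
qed

lemma dual_norm_le:
  assumes "\<And>f. f \<in> Lip0 M p \<Longrightarrow> lip_norm M f \<le> 1 \<Longrightarrow> \<bar>\<phi> f\<bar> \<le> C"
  shows "dual_norm M p \<phi> \<le> C"
  unfolding dual_norm_def
proof (rule cSup_least)
  have "lip_norm M (0::_ \<Rightarrow> real) \<le> 1" by (rule lip_norm_le) auto
  moreover have "0 \<in> Lip0 M p" by (rule subspace_0[OF subspace_Lip0])
  ultimately show "{\<bar>\<phi> f\<bar> |f. f \<in> Lip0 M p \<and> lip_norm M f \<le> 1} \<noteq> {}" by blast
qed (use assms in auto)

lemma dual_norm_upper:
  assumes "\<phi> \<in> Lip0_dual M p" "f \<in> Lip0 M p" "lip_norm M f \<le> 1"
  shows "\<bar>\<phi> f\<bar> \<le> dual_norm M p \<phi>"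
proof -
  obtain C where C: "\<And>f. f \<in> Lip0 M p \<Longrightarrow> \<bar>\<phi> f\<bar> \<le> C * lip_norm M f"
    using Lip0_dual_bounded[OF assms(1)] by blast
  have "\<bar>\<phi> f\<bar> \<le> \<bar>C\<bar>" if "f \<in> Lip0 M p" "lip_norm M f \<le> 1" for f
  proof -
    have "C * lip_norm M f \<le> \<bar>C\<bar> * 1"
      using that lip_norm_nonneg[OF that(1)] by (intro mult_mono) auto
    with C[OF that(1)] show ?thesis by simp
  qed
  then have "bdd_above {\<bar>\<phi> f\<bar> |f. f \<in> Lip0 M p \<and> lip_norm M f \<le> 1}"
    by (intro bdd_aboveI[of _ "\<bar>C\<bar>"]) auto
  then show ?thesis unfolding dual_norm_def using assms by (intro cSup_upper) auto
qed

lemma dual_norm_nonneg: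
  assumes "\<phi> \<in> Lip0_dual M p"
  shows "0 \<le> dual_norm M p \<phi>"
proof -
  have "lip_norm M (0::_ \<Rightarrow> real) \<le> 1" by (rule lip_norm_le) auto
  then have "\<bar>\<phi> 0\<bar> \<le> dual_norm M p \<phi>"
    by (intro dual_norm_upper assms subspace_0[OF subspace_Lip0])
  then show ?thesis by linarith
qed

lemma dual_norm_bound:
  assumes \<phi>: "\<phi> \<in> Lip0_dual M p" and f: "f \<in> Lip0 M p"
  shows "\<bar>\<phi> f\<bar> \<le> dual_norm M p \<phi> * lip_norm M f"
proof (cases "lip_norm M f = 0")
  \<comment> \<open>Normalising \<open>f\<close> is impossible here, but boundedness of the
    functional forces \<open>\<phi> f = 0\<close>.\<close>
  case True
  then show ?thesis using assms by (force simp: Lip0_dual_def)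
next
  case False
  then have l: "lip_norm M f > 0" using lip_norm_nonneg[OF f] by simp
  let ?g = "inverse (lip_norm M f) *\<^sub>R f"
  have "?g \<in> Lip0 M p" using f subspace_Lip0 by (blast intro: subspace_scale)
  moreover have "lip_norm M ?g \<le> 1"
    using lip_norm_scaleR_le[OF f, of "inverse (lip_norm M f)"] l by simp
  ultimately have "\<bar>\<phi> ?g\<bar> \<le> dual_norm M p \<phi>" by (rule dual_norm_upper[OF \<phi>])
  then show ?thesis
    unfolding Lip0_dual_scaleR[OF \<phi> f] using l by (simp add: abs_mult field_simps)
qed

lemma dual_norm_triangle:
  assumes "\<phi> \<in> Lip0_dual M p" "\<psi> \<in> Lip0_dual M p"
  shows "dual_norm M p (\<phi> + \<psi>) \<le> dual_norm M p \<phi> + dual_norm M p \<psi>"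
proof (rule dual_norm_le)
  fix f assume "f \<in> Lip0 M p" "lip_norm M f \<le> 1"
  then show "\<bar>(\<phi> + \<psi>) f\<bar> \<le> dual_norm M p \<phi> + dual_norm M p \<psi>"
    using dual_norm_upper[OF assms(1), of f] dual_norm_upper[OF assms(2), of f] by simp
qed

lemma dual_norm_scaleR_le:
  assumes "\<phi> \<in> Lip0_dual M p"
  shows "dual_norm M p (c *\<^sub>R \<phi>) \<le> \<bar>c\<bar> * dual_norm M p \<phi>"
proof (rule dual_norm_le)
  fix f assume "f \<in> Lip0 M p" "lip_norm M f \<le> 1"
  then show "\<bar>(c *\<^sub>R \<phi>) f\<bar> \<le> \<bar>c\<bar> * dual_norm M p \<phi>"
    using dual_norm_upper[OF assms, of f] by (simp add: scaleR_fun_def abs_mult mult_left_mono)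
qed

lemma dual_norm_uminus:
  assumes "\<phi> \<in> Lip0_dual M p"
  shows "dual_norm M p (- \<phi>) = dual_norm M p \<phi>"
proof -
  have "- \<phi> \<in> Lip0_dual M p" by (rule subspace_neg[OF subspace_Lip0_dual assms])
  then show ?thesis
    using dual_norm_scaleR_le[OF assms, of "-1"] dual_norm_scaleR_le[of "- \<phi>" M p "-1"] by simp
qed

lemma dual_norm_sum_scaleR_le:
  assumes "\<And>b. b \<in> B \<Longrightarrow> \<phi> b \<in> Lip0_dual M p"
  shows "dual_norm M p (\<Sum>b\<in>B. c b *\<^sub>R \<phi> b) \<le> (\<Sum>b\<in>B. \<bar>c b\<bar> * dual_norm M p (\<phi> b))"
  using assms
proof (induction B rule: infinite_finite_induct)
  case (insert b B)
  have "(\<Sum>b\<in>B. c b *\<^sub>R \<phi> b) \<in> Lip0_dual M p"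
    using insert.prems by (intro subspace_sum subspace_scale subspace_Lip0_dual) auto
  moreover have "c b *\<^sub>R \<phi> b \<in> Lip0_dual M p"
    using insert.prems by (intro subspace_scale subspace_Lip0_dual) auto
  ultimately have "dual_norm M p (c b *\<^sub>R \<phi> b + (\<Sum>b\<in>B. c b *\<^sub>R \<phi> b))
      \<le> dual_norm M p (c b *\<^sub>R \<phi> b) + dual_norm M p (\<Sum>b\<in>B. c b *\<^sub>R \<phi> b)"
    by (intro dual_norm_triangle)
  moreover have "dual_norm M p (c b *\<^sub>R \<phi> b) \<le> \<bar>c b\<bar> * dual_norm M p (\<phi> b)"
    using insert.prems by (intro dual_norm_scaleR_le) simp
  moreover have "dual_norm M p (\<Sum>b\<in>B. c b *\<^sub>R \<phi> b) \<le> (\<Sum>b\<in>B. \<bar>c b\<bar> * dual_norm M p (\<phi> b))"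
    using insert by simp
  ultimately show ?case unfolding sum.insert[OF insert.hyps] by linarith
qed (auto intro: dual_norm_le)

section \<open>Evaluations and their finite combinations\<close>

text \<open>As \<open>f\<close> vanishes at \<open>p\<close>, the value \<open>f m\<close> is an
  increment of \<open>f\<close> from \<open>p\<close> to \<open>m\<close>, so
  \<open>dist m p\<close> bounds the evaluation.\<close>

lemma point_eval_in_Lip0_dual:
  assumes "m \<in> M" "p \<in> M"
  shows "point_eval M p m \<in> Lip0_dual M p"
proof -
  have "\<bar>f m\<bar> \<le> dist m p * lip_norm M f" if "f \<in> Lip0 M p" for f
    using lip_norm_bound[OF that assms] Lip0_vanish[OF that] by (simp add: mult.commute)
  then show ?thesis
    using subspace_add[OF subspace_Lip0, of _ M p] subspace_scale[OF subspace_Lip0, of _ M p]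
    by (auto simp: Lip0_dual_def point_eval_def scaleR_fun_def)
qed

lemma span_point_eval_subset_Lip0_dual:
  assumes "N \<subseteq> M" "p \<in> M"
  shows "span (point_eval M p ` N) \<subseteq> Lip0_dual M p"
  using assms by (intro span_minimal subspace_Lip0_dual) (auto intro: point_eval_in_Lip0_dual)

text \<open>Combinations of evaluations at \<open>N\<close> see only the values on \<open>N\<close>.
  The factor \<open>r\<close> accommodates an extension of a scaled function.\<close>

lemma span_point_eval_scale_on:
  assumes "\<psi> \<in> span (point_eval M p ` N)" "f \<in> Lip0 M p" "g \<in> Lip0 M p"
    and "\<And>x. x \<in> N \<Longrightarrow> g x = r * f x"
  shows "\<psi> g = r * \<psi> f"
  using assms(1)
proof (induction rule: span_induct_alt)
  case (step c x y)
  then show ?case using assms(2-4) by (auto simp: scaleR_fun_def point_eval_def algebra_simps)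
qed simp

lemma span_finite_support:
  assumes "x \<in> span (h ` M)"
  obtains N where "finite N" "N \<subseteq> M" "x \<in> span (h ` N)"
proof -
  obtain T r where "finite T" "T \<subseteq> h ` M" and x: "x = (\<Sum>a\<in>T. r a *\<^sub>R a)"
    using assms by (auto simp: span_explicit)
  then obtain N where "finite N" "N \<subseteq> M" "T = h ` N" by (meson finite_subset_image)
  moreover have "x \<in> span T" unfolding x by (intro span_sum span_scale span_base)
  ultimately show thesis by (intro that[of N]) auto
qed

section \<open>Norming functions extended to a long trapezoid\<close>

text \<open>The formula with a maximum gives the smallest 1-Lipschitz extension. That each value is
  attained at some point of \<open>S\<close> is part of the conclusion, so that a value outside
  \<open>S\<close> can later be computed from such a point.\<close>

lemma McShane_extension_finite:
  fixes h :: "'a::metric_space \<Rightarrow> real"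
  assumes "finite S" "S \<noteq> {}" "\<And>x y. x \<in> S \<Longrightarrow> y \<in> S \<Longrightarrow> \<bar>h x - h y\<bar> \<le> dist x y"
  obtains H where "\<And>x. x \<in> S \<Longrightarrow> H x = h x" "\<And>y z. \<bar>H y - H z\<bar> \<le> dist y z"
    "\<And>z. \<exists>x\<in>S. H z = h x - dist x z"
proof
  define H where "H z = Max ((\<lambda>x. h x - dist x z) ` S)" for z
  have ge: "h x - dist x z \<le> H z" if "x \<in> S" for x z
    unfolding H_def using assms that by (intro Max_ge) auto
  show att: "\<exists>x\<in>S. H z = h x - dist x z" for z
  proof -
    have "H z \<in> (\<lambda>x. h x - dist x z) ` S"
      unfolding H_def using assms by (intro Max_in) auto
    then show ?thesis by blast
  qed
  show "H x = h x" if x: "x \<in> S" for x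
  proof -
    obtain y where y: "y \<in> S" "H x = h y - dist y x" using att by blast
    have "h y - dist y x \<le> h x" using assms(3)[OF y(1) x] by linarith
    with y ge[OF x, of x] show ?thesis by simp
  qed
  have "H y - H z \<le> dist y z" for y z
  proof -
    obtain x where x: "x \<in> S" "H y = h x - dist x y" using att by blast
    have "dist x z \<le> dist x y + dist y z" by (rule dist_triangle)
    with x ge[OF x(1), of z] show ?thesis by simp
  qed
  from this[of y z for y z] this[of z y for y z]
  show "\<bar>H y - H z\<bar> \<le> dist y z" for y z by (smt (verit) dist_commute)
qed

text \<open>The value at \<open>u\<close> is made as large as the 1-Lipschitz condition permits, and
  then the value at \<open>v\<close> as small as possible. Their difference is either
  \<open>dist u v\<close> or governed by two points of \<open>N\<close>, where the trapezoid
  inequality absorbs the possible decrease of \<open>h\<close>, whose slope is at most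
  \<open>1 - \<epsilon>\<close>.\<close>

lemma Lip0_extension_long_trapezoid:
  fixes h :: "'a::metric_space \<Rightarrow> real"
  assumes N: "finite N" "N \<subseteq> M" "p \<in> N" and uv: "u \<in> M" "v \<in> M" "u \<noteq> v" and "0 \<le> \<epsilon>"
    and h: "h p = 0" "\<And>x y. x \<in> N \<Longrightarrow> y \<in> N \<Longrightarrow> \<bar>h x - h y\<bar> \<le> (1 - \<epsilon>) * dist x y"
    and ltp: "\<And>x y. x \<in> N \<Longrightarrow> y \<in> N \<Longrightarrow>
      (1 - \<epsilon>) * (dist x y + dist u v) \<le> dist x u + dist y v"
  obtains H where "H \<in> Lip0 M p" "lip_norm M H \<le> 1" "\<And>x. x \<in> N \<Longrightarrow> H x = h x"
    "H u - H v \<ge> (1 - \<epsilon>) * dist u v"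
proof -
  have le: "(1 - \<epsilon>) * dist x y \<le> dist x y" for x y :: 'a
    using \<open>0 \<le> \<epsilon>\<close> by (simp add: mult_left_le_one_le left_diff_distrib)
  define a where "a = Min ((\<lambda>x. h x + dist x u) ` N)"
  have a_le: "a \<le> h x + dist x u" if "x \<in> N" for x
    unfolding a_def using N that by (intro Min_le) auto
  have "a \<in> (\<lambda>x. h x + dist x u) ` N"
    unfolding a_def using N by (intro Min_in) auto
  then obtain x0 where x0: "x0 \<in> N" "a = h x0 + dist x0 u" by blast
  have hlip: "\<bar>h x - h y\<bar> \<le> dist x y" if "x \<in> N" "y \<in> N" for x y
    using h(2)[OF that] le[of x y] by linarith
  have a_lip: "\<bar>h x - a\<bar> \<le> dist x u" if "x \<in> N" for x
    using a_le[OF that] x0(2) hlip[OF that x0(1)] dist_triangle2[of x x0 u] by linarith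
  \<comment> \<open>If \<open>u\<close> already belongs to \<open>N\<close>, its value is forced to
    be \<open>a\<close>, so overwriting \<open>h\<close> at \<open>u\<close> does not change it on
    \<open>N\<close>.\<close>
  have a_eq: "h u = a" if "u \<in> N" using a_lip[OF that] by simp
  define k where "k = h(u := a)"
  have k: "k x = h x" if "x \<in> N" for x using a_eq that by (auto simp: k_def)
  have ku: "k u = a" by (simp add: k_def)
  have "\<bar>k x - k y\<bar> \<le> dist x y" if "x \<in> insert u N" "y \<in> insert u N" for x y
  proof (cases "x = u"; cases "y = u")
    assume "x = u" "y \<noteq> u"
    then show ?thesis using that a_lip[of y] k[of y] ku by (simp add: dist_commute[of u])
  qed (use that hlip a_lip k ku in auto)
  then obtain G where G: "\<And>x. x \<in> insert u N \<Longrightarrow> G x = k x"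
    "\<And>y z. \<bar>G y - G z\<bar> \<le> dist y z" "\<And>z. \<exists>x\<in>insert u N. G z = k x - dist x z"
    using McShane_extension_finite[of "insert u N" k] N(1) by blast
  define H where "H z = (if z \<in> M then G z else 0)" for z
  have Hlip: "\<bar>H x - H y\<bar> \<le> dist x y" if "x \<in> M" "y \<in> M" for x y
    using G(2) that by (simp add: H_def)
  have HN: "H x = h x" if "x \<in> N" for x
    using that G(1) k N by (auto simp: H_def)
  have "1-lipschitz_on M H" using Hlip by (intro lipschitz_onI) (auto simp: dist_real_def)
  then have "H \<in> Lip0 M p" using HN[OF N(3)] h(1) by (auto simp: Lip0_def H_def)
  moreover have "lip_norm M H \<le> 1" using Hlip by (intro lip_norm_le) auto
  moreover have "H u - H v \<ge> (1 - \<epsilon>) * dist u v"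
  proof -
    obtain x where x: "x \<in> insert u N" "G v = k x - dist x v" using G(3) by blast
    have Hu: "H u = a" "H v = G v" using uv G(1)[of u] ku by (auto simp: H_def)
    show ?thesis
    proof (cases "x = u")
      case True
      then show ?thesis using x Hu ku le[of u v] by simp
    next
      case False
      then have xN: "x \<in> N" using x by simp
      have "H u - H v = (h x0 - h x) + dist x0 u + dist x v"
        using Hu x k[OF xN] x0 by simp
      \<comment> \<open>\<open>x0\<close> attains the minimum defining the value at
        \<open>u\<close>, and \<open>x\<close> attains the maximum defining the value at
        \<open>v\<close>; the trapezoid inequality is applied to this pair.\<close>
      moreover have "h x0 - h x \<ge> - ((1 - \<epsilon>) * dist x0 x)" using h(2)[OF x0(1) xN] by linarith
      ultimately show ?thesis using ltp[OF x0(1) xN] by (simp add: distrib_left)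
    qed
  qed
  ultimately show thesis using HN that by blast
qed

section \<open>Normalised differences of two evaluations\<close>

definition molecule :: "'a::metric_space set \<Rightarrow> 'a \<Rightarrow> 'a \<Rightarrow> 'a \<Rightarrow> ('a \<Rightarrow> real) \<Rightarrow> real" where
  "molecule M p u v = (1 / dist u v) *\<^sub>R (point_eval M p u - point_eval M p v)"

lemma molecule_apply: "f \<in> Lip0 M p \<Longrightarrow> molecule M p u v f = (f u - f v) / dist u v"
  by (simp add: molecule_def scaleR_fun_def point_eval_def)

lemma molecule_in_span: "u \<in> M \<Longrightarrow> v \<in> M \<Longrightarrow> molecule M p u v \<in> span (point_eval M p ` M)"
  unfolding molecule_def by (intro span_scale span_diff span_base) auto

lemma molecule_in_Lip0_dual:
  "u \<in> M \<Longrightarrow> v \<in> M \<Longrightarrow> p \<in> M \<Longrightarrow> molecule M p u v \<in> Lip0_dual M p"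
  using molecule_in_span span_point_eval_subset_Lip0_dual by blast

text \<open>The upper bound is the Lipschitz estimate; the distance to \<open>v\<close>, shifted to
  vanish at \<open>p\<close>, attains the value \<open>1\<close>.\<close>

lemma dual_norm_molecule:
  assumes "u \<in> M" "v \<in> M" "p \<in> M" "u \<noteq> v"
  shows "dual_norm M p (molecule M p u v) = 1"
proof (rule antisym)
  show "dual_norm M p (molecule M p u v) \<le> 1"
  proof (rule dual_norm_le)
    fix f assume f: "f \<in> Lip0 M p" "lip_norm M f \<le> 1"
    have "\<bar>f u - f v\<bar> \<le> lip_norm M f * dist u v" using lip_norm_bound f assms by blast
    also have "\<dots> \<le> 1 * dist u v" using f by (intro mult_right_mono) auto
    finally show "\<bar>molecule M p u v f\<bar> \<le> 1"
      using f assms by (simp add: molecule_apply)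
  qed
next
  define f where "f z = (if z \<in> M then dist z v - dist p v else 0)" for z
  have lip: "\<bar>f x - f y\<bar> \<le> dist x y" if "x \<in> M" "y \<in> M" for x y
    using that by (simp add: f_def) (smt (verit) dist_commute dist_triangle)
  then have "1-lipschitz_on M f" by (intro lipschitz_onI) (auto simp: dist_real_def)
  then have "f \<in> Lip0 M p" using assms by (auto simp: Lip0_def f_def)
  moreover have "lip_norm M f \<le> 1" using lip by (intro lip_norm_le) auto
  ultimately have "\<bar>molecule M p u v f\<bar> \<le> dual_norm M p (molecule M p u v)"
    using assms by (intro dual_norm_upper molecule_in_Lip0_dual)
  moreover have "molecule M p u v f = 1"
    using \<open>f \<in> Lip0 M p\<close> assms by (simp add: molecule_apply f_def)
  ultimately show "1 \<le> dual_norm M p (molecule M p u v)" by simp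
qed

text \<open>For nonnegative \<open>c\<close>, a test function \<open>f\<close> for
  \<open>\<psi>\<close> is scaled by \<open>1 - \<epsilon>\<close> on \<open>N\<close> and extended
  so that the molecule is also almost normed. A negative \<open>c\<close> is reduced to this case by
  negating the whole functional.\<close>

lemma dual_norm_add_molecule_ge:
  assumes N: "finite N" "N \<subseteq> M" "p \<in> N" and uv: "u \<in> M" "v \<in> M" "u \<noteq> v"
    and \<epsilon>: "0 \<le> \<epsilon>" "\<epsilon> < 1"
    and ltp: "\<And>x y. x \<in> N \<Longrightarrow> y \<in> N \<Longrightarrow>
      (1 - \<epsilon>) * (dist x y + dist u v) \<le> dist x u + dist y v"
    and \<psi>: "\<psi> \<in> span (point_eval M p ` N)"
  shows "dual_norm M p (\<psi> + c *\<^sub>R molecule M p u v) \<ge> (1 - \<epsilon>) * (dual_norm M p \<psi> + \<bar>c\<bar>)"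
proof -
  let ?m = "molecule M p u v"
  have p: "p \<in> M" using N by blast
  have m: "?m \<in> Lip0_dual M p" using uv p by (intro molecule_in_Lip0_dual)
  have dual: "\<psi> \<in> Lip0_dual M p" if "\<psi> \<in> span (point_eval M p ` N)" for \<psi>
    using that span_point_eval_subset_Lip0_dual N(2) p by blast
  have sum_dual: "\<psi> + c *\<^sub>R ?m \<in> Lip0_dual M p"
    if "\<psi> \<in> span (point_eval M p ` N)" for \<psi> c
    using dual[OF that] m subspace_Lip0_dual by (intro subspace_add subspace_scale)
  have pos: "dual_norm M p (\<psi> + c *\<^sub>R ?m) \<ge> (1 - \<epsilon>) * (dual_norm M p \<psi> + c)"
    if \<psi>: "\<psi> \<in> span (point_eval M p ` N)" and c: "c \<ge> 0" for \<psi> c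
  proof -
    have key: "(1 - \<epsilon>) * (\<psi> f + c) \<le> dual_norm M p (\<psi> + c *\<^sub>R ?m)"
      if f: "f \<in> Lip0 M p" "lip_norm M f \<le> 1" for f
    proof -
      have "\<bar>(1 - \<epsilon>) * f x - (1 - \<epsilon>) * f y\<bar> \<le> (1 - \<epsilon>) * dist x y" if "x \<in> N" "y \<in> N" for x y
      proof -
        have "\<bar>f x - f y\<bar> \<le> lip_norm M f * dist x y" using lip_norm_bound f N that by blast
        also have "\<dots> \<le> 1 * dist x y" using f by (intro mult_right_mono) auto
        finally have "(1 - \<epsilon>) * \<bar>f x - f y\<bar> \<le> (1 - \<epsilon>) * dist x y"
          using \<epsilon> by (intro mult_left_mono) auto
        then show ?thesis using \<epsilon> by (simp add: abs_mult flip: right_diff_distrib)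
      qed
      moreover have "(1 - \<epsilon>) * f p = 0" using Lip0_vanish[OF f(1)] by simp
      ultimately obtain H where H: "H \<in> Lip0 M p" "lip_norm M H \<le> 1"
        "\<And>x. x \<in> N \<Longrightarrow> H x = (1 - \<epsilon>) * f x" "H u - H v \<ge> (1 - \<epsilon>) * dist u v"
        using Lip0_extension_long_trapezoid[OF N uv \<epsilon>(1), of "\<lambda>x. (1 - \<epsilon>) * f x"] ltp by blast
      have "?m H \<ge> 1 - \<epsilon>" using H(1,4) uv by (simp add: molecule_apply field_simps)
      then have "c * (1 - \<epsilon>) \<le> c * ?m H" using c by (rule mult_left_mono)
      moreover have "\<psi> H = (1 - \<epsilon>) * \<psi> f"
        by (rule span_point_eval_scale_on[OF \<psi> f(1) H(1,3)])
      moreover have "\<bar>(\<psi> + c *\<^sub>R ?m) H\<bar> \<le> dual_norm M p (\<psi> + c *\<^sub>R ?m)"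
        by (rule dual_norm_upper[OF sum_dual[OF \<psi>] H(1,2)])
      ultimately show ?thesis by (simp add: scaleR_fun_def algebra_simps)
    qed
    \<comment> \<open>Isolating the norm of \<open>\<psi>\<close> reduces the claim to a bound for
      each test function. Applying \<open>key\<close> to \<open>f\<close> and to its negative
      supplies the absolute value.\<close>
    have "dual_norm M p \<psi> \<le> dual_norm M p (\<psi> + c *\<^sub>R ?m) / (1 - \<epsilon>) - c"
    proof (rule dual_norm_le)
      fix f assume f: "f \<in> Lip0 M p" "lip_norm M f \<le> 1"
      have "(-1) *\<^sub>R f \<in> Lip0 M p" using f subspace_Lip0 by (blast intro: subspace_scale)
      moreover have "lip_norm M ((-1) *\<^sub>R f) \<le> 1" using lip_norm_scaleR_le[OF f(1), of "-1"] f by simp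
      ultimately have "(1 - \<epsilon>) * (- \<psi> f + c) \<le> dual_norm M p (\<psi> + c *\<^sub>R ?m)"
        using key[of "(-1) *\<^sub>R f"] Lip0_dual_scaleR[OF dual[OF \<psi>] f(1), of "-1"] by simp
      with key[OF f] have "\<psi> f + c \<le> dual_norm M p (\<psi> + c *\<^sub>R ?m) / (1 - \<epsilon>)"
        "- \<psi> f + c \<le> dual_norm M p (\<psi> + c *\<^sub>R ?m) / (1 - \<epsilon>)"
        using \<epsilon> by (simp_all add: pos_le_divide_eq mult.commute)
      then show "\<bar>\<psi> f\<bar> \<le> dual_norm M p (\<psi> + c *\<^sub>R ?m) / (1 - \<epsilon>) - c" by linarith
    qed
    then show ?thesis using \<epsilon> by (simp add: field_simps)
  qed
  show ?thesis
  proof (cases "c \<ge> 0")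
    case True
    then show ?thesis using pos[OF \<psi>] by simp
  next
    case False
    have "dual_norm M p (- \<psi> + (- c) *\<^sub>R ?m) = dual_norm M p (\<psi> + c *\<^sub>R ?m)"
      using dual_norm_uminus[OF sum_dual[OF \<psi>], of c] by simp
    moreover have "dual_norm M p (- \<psi>) = dual_norm M p \<psi>" by (rule dual_norm_uminus[OF dual[OF \<psi>]])
    ultimately show ?thesis using pos[OF span_neg[OF \<psi>], of "- c"] False by simp
  qed
qed

section \<open>Octahedrality\<close>

text \<open>This is the algebraic fact about common kernels of finitely many functionals. Elements
  of \<open>Lip0_dual M p\<close> vanish outside \<open>Lip0 M p\<close>, so agreement on
  \<open>Lip0 M p\<close> is equality.\<close>

lemma functional_in_span_if_vanishes:
  assumes "finite B" "B \<subseteq> Lip0_dual M p" "b \<in> Lip0_dual M p"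
    and "\<And>f. f \<in> Lip0 M p \<Longrightarrow> (\<And>a. a \<in> B \<Longrightarrow> a f = 0) \<Longrightarrow> b f = 0"
  shows "b \<in> span B"
  using assms
proof (induction B arbitrary: b rule: finite_induct)
  case empty
  have "b f = 0" for f
    using empty by (cases "f \<in> Lip0 M p") (auto simp: Lip0_dual_def)
  then have "b = 0" by (intro ext) simp
  then show ?case by (simp only: span_zero)
next
  case (insert a B)
  have a: "a \<in> Lip0_dual M p" and B: "B \<subseteq> Lip0_dual M p" using insert.prems by auto
  show ?case
  proof (cases "\<forall>f\<in>Lip0 M p. (\<forall>a'\<in>B. a' f = 0) \<longrightarrow> a f = 0")
    case True
    then have "b \<in> span B" using insert.prems by (intro insert.IH) auto
    then show ?thesis by (meson span_mono subset_insertI subsetD)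
  next
    case False
    then obtain g where g: "g \<in> Lip0 M p" "\<And>a'. a' \<in> B \<Longrightarrow> a' g = 0" "a g \<noteq> 0" by blast
    \<comment> \<open>With this \<open>r\<close>, the functional \<open>b - r *\<^sub>R a\<close>
      vanishes at \<open>g\<close>.\<close>
    define r where "r = b g / a g"
    have "b - r *\<^sub>R a \<in> span B"
    proof (rule insert.IH)
      show "b - r *\<^sub>R a \<in> Lip0_dual M p"
        using insert.prems(2) a subspace_Lip0_dual by (intro subspace_diff subspace_scale)
      fix f assume f: "f \<in> Lip0 M p" "\<And>a'. a' \<in> B \<Longrightarrow> a' f = 0"
      \<comment> \<open>Subtracting \<open>s *\<^sub>R g\<close> moves \<open>f\<close> into the
        kernel of \<open>a\<close> without leaving the kernels of the functionals in
        \<open>B\<close>.\<close>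
      define s where "s = a f / a g"
      have sg: "s *\<^sub>R g \<in> Lip0 M p" using g subspace_Lip0 by (blast intro: subspace_scale)
      have eval: "\<phi> (f - s *\<^sub>R g) = \<phi> f - s * \<phi> g" if "\<phi> \<in> Lip0_dual M p" for \<phi>
        using that Lip0_dual_diff[OF that f(1) sg] Lip0_dual_scaleR[OF that g(1)] by simp
      have "b (f - s *\<^sub>R g) = 0"
      proof (rule insert.prems(3))
        show "f - s *\<^sub>R g \<in> Lip0 M p" using f sg subspace_Lip0 by (blast intro: subspace_diff)
        fix a' assume a': "a' \<in> insert a B"
        then have "a' \<in> Lip0_dual M p" using a B by blast
        from eval[OF this] have "a' (f - s *\<^sub>R g) = a' f - s * a' g" .
        moreover have "a' f = s * a' g"
          using a'
        proof
          assume "a' = a"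
          then show ?thesis using g(3) by (simp add: s_def)
        next
          assume "a' \<in> B"
          from f(2)[OF this] g(2)[OF this] show ?thesis by (simp only: mult_zero_right)
        qed
        ultimately show "a' (f - s *\<^sub>R g) = 0" by simp
      qed
      then have "b f = s * b g" using eval[OF insert.prems(2)] by simp
      then show "(b - r *\<^sub>R a) f = 0" using g by (simp add: scaleR_fun_def r_def s_def)
    qed (rule B)
    then show ?thesis by (auto simp: span_breakdown_eq)
  qed
qed

text \<open>Each coefficient is read off by a Lipschitz function annihilating the other basis vectors,
  so no compactness of the unit sphere is needed.\<close>

lemma independent_coefficients_bounded:
  assumes "finite B" "B \<subseteq> Lip0_dual M p" "independent B"
  shows "\<exists>C\<ge>0. \<forall>c. (\<Sum>b\<in>B. \<bar>c b\<bar>) \<le> C * dual_norm M p (\<Sum>b\<in>B. c b *\<^sub>R b)"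
proof -
  have "\<forall>b\<in>B. \<exists>f\<in>Lip0 M p. (\<forall>a\<in>B - {b}. a f = 0) \<and> b f \<noteq> 0"
  proof
    fix b assume b: "b \<in> B"
    then have "b \<notin> span (B - {b})" using assms(3) by (auto simp: dependent_def)
    then show "\<exists>f\<in>Lip0 M p. (\<forall>a\<in>B - {b}. a f = 0) \<and> b f \<noteq> 0"
      using functional_in_span_if_vanishes[of "B - {b}" M p b] assms b by blast
  qed
  then obtain F where F: "\<And>b. b \<in> B \<Longrightarrow> F b \<in> Lip0 M p"
    "\<And>b a. b \<in> B \<Longrightarrow> a \<in> B - {b} \<Longrightarrow> a (F b) = 0" "\<And>b. b \<in> B \<Longrightarrow> b (F b) \<noteq> 0" by metis
  \<comment> \<open>Evaluating a combination at \<open>F b\<close> isolates the coefficient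
    \<open>c b\<close>, and each summand is the resulting bound for one coefficient.\<close>
  define C where "C = (\<Sum>b\<in>B. lip_norm M (F b) / \<bar>b (F b)\<bar>)"
  have "C \<ge> 0" unfolding C_def using F(1) lip_norm_nonneg by (intro sum_nonneg) fastforce
  moreover have "(\<Sum>b\<in>B. \<bar>c b\<bar>) \<le> C * dual_norm M p (\<Sum>b\<in>B. c b *\<^sub>R b)" for c
  proof -
    define y where "y = (\<Sum>b\<in>B. c b *\<^sub>R b)"
    have y: "y \<in> Lip0_dual M p"
      unfolding y_def using assms by (intro subspace_sum subspace_scale subspace_Lip0_dual) auto
    have sum_apply: "(\<Sum>a\<in>A. c a *\<^sub>R a) f = (\<Sum>a\<in>A. c a * a f)"
      for A :: "(('a \<Rightarrow> real) \<Rightarrow> real) set" and f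
      by (induction A rule: infinite_finite_induct) (auto simp: scaleR_fun_def)
    have "\<bar>c b\<bar> \<le> lip_norm M (F b) / \<bar>b (F b)\<bar> * dual_norm M p y" if b: "b \<in> B" for b
    proof -
      have "y (F b) = (\<Sum>a\<in>B. if a = b then c b * b (F b) else 0)"
        unfolding y_def sum_apply using F(2)[OF b] by (intro sum.cong) auto
      then have "y (F b) = c b * b (F b)" using b assms(1) by simp
      then have "\<bar>c b\<bar> * \<bar>b (F b)\<bar> \<le> dual_norm M p y * lip_norm M (F b)"
        using dual_norm_bound[OF y F(1)[OF b]] by (simp add: abs_mult)
      then show ?thesis using F(3)[OF b] by (simp add: field_simps)
    qed
    then have "(\<Sum>b\<in>B. \<bar>c b\<bar>) \<le> (\<Sum>b\<in>B. lip_norm M (F b) / \<bar>b (F b)\<bar> * dual_norm M p y)"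
      by (rule sum_mono)
    then show ?thesis by (simp add: C_def y_def sum_distrib_right)
  qed
  ultimately show ?thesis by blast
qed

text \<open>It suffices to approximate the members of a basis: as the coefficients are bounded by a
  multiple of the norm, the error is relative to the norm, uniformly on the whole subspace.\<close>

lemma finite_dim_approximation_by_finite_support:
  assumes "p \<in> M" "finite B" "span B \<subseteq> free_space M p" "\<eta> > 0"
  obtains N where "finite N" "N \<subseteq> M" "p \<in> N"
    "\<And>y. y \<in> span B \<Longrightarrow> \<exists>\<psi> \<in> span (point_eval M p ` N).
      dual_norm M p (y - \<psi>) \<le> \<eta> * dual_norm M p y"
proof -
  obtain A where A: "A \<subseteq> B" "independent A" "B \<subseteq> span A"
    using maximal_independent_subset by blast
  have finA: "finite A" using A assms finite_subset by blast
  have span: "span A = span B" using A by (metis span_mono span_span subset_antisym)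
  have AF: "A \<subseteq> free_space M p" using assms(3) span span_superset by blast
  then have AL: "A \<subseteq> Lip0_dual M p" by (auto simp: free_space_def)
  obtain C where C: "C \<ge> 0"
    "\<And>c. (\<Sum>b\<in>A. \<bar>c b\<bar>) \<le> C * dual_norm M p (\<Sum>b\<in>A. c b *\<^sub>R b)"
    using independent_coefficients_bounded[OF finA AL A(2)] by blast
  define \<theta> where "\<theta> = \<eta> / (C + 1)"
  have \<theta>: "\<theta> > 0" "\<theta> * C \<le> \<eta>" using C assms by (auto simp: \<theta>_def field_simps)
  have "\<forall>b\<in>A. \<exists>\<psi>\<in>span (point_eval M p ` M). dual_norm M p (b - \<psi>) < \<theta>"
    using AF \<theta> by (auto simp: free_space_def)
  then obtain \<Psi> where \<Psi>: "\<And>b. b \<in> A \<Longrightarrow> \<Psi> b \<in> span (point_eval M p ` M)"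
    "\<And>b. b \<in> A \<Longrightarrow> dual_norm M p (b - \<Psi> b) < \<theta>" by metis
  have "\<forall>b\<in>A. \<exists>N. finite N \<and> N \<subseteq> M \<and> \<Psi> b \<in> span (point_eval M p ` N)"
    using \<Psi>(1) span_finite_support by metis
  then obtain S where S: "\<And>b. b \<in> A \<Longrightarrow> finite (S b) \<and> S b \<subseteq> M \<and> \<Psi> b \<in> span (point_eval M p ` S b)"
    by metis
  \<comment> \<open>The distinguished point is included because Lipschitz extensions from
    \<open>N\<close> have to vanish there.\<close>
  define N where "N = insert p (\<Union>b\<in>A. S b)"
  have N: "finite N" "N \<subseteq> M" "p \<in> N" using S finA assms by (auto simp: N_def)
  have \<Psi>N: "\<Psi> b \<in> span (point_eval M p ` N)" if "b \<in> A" for b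
  proof -
    have "span (point_eval M p ` S b) \<subseteq> span (point_eval M p ` N)"
      using that by (intro span_mono image_mono) (auto simp: N_def)
    then show ?thesis using S[OF that] by blast
  qed
  show thesis
  proof (rule that[OF N])
    fix y assume "y \<in> span B"
    then obtain c where y: "y = (\<Sum>b\<in>A. c b *\<^sub>R b)"
      using span_finite[OF finA] unfolding span[symmetric] by auto
    define \<psi> where "\<psi> = (\<Sum>b\<in>A. c b *\<^sub>R \<Psi> b)"
    have "\<psi> \<in> span (point_eval M p ` N)"
      unfolding \<psi>_def using \<Psi>N by (intro span_sum span_scale) auto
    moreover have "dual_norm M p (y - \<psi>) \<le> \<eta> * dual_norm M p y"
    proof -
      have yL: "y \<in> Lip0_dual M p"
        unfolding y using AL by (intro subspace_sum subspace_scale subspace_Lip0_dual) auto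
      have "b - \<Psi> b \<in> Lip0_dual M p" if "b \<in> A" for b
        using that AL \<Psi>(1) span_point_eval_subset_Lip0_dual[of M M p] assms(1)
        by (intro subspace_diff[OF subspace_Lip0_dual]) auto
      moreover have "y - \<psi> = (\<Sum>b\<in>A. c b *\<^sub>R (b - \<Psi> b))"
        by (simp add: y \<psi>_def scaleR_diff_right sum_subtractf)
      ultimately have "dual_norm M p (y - \<psi>) \<le> (\<Sum>b\<in>A. \<bar>c b\<bar> * dual_norm M p (b - \<Psi> b))"
        using dual_norm_sum_scaleR_le[of A "\<lambda>b. b - \<Psi> b" M p c] by simp
      also have "\<dots> \<le> (\<Sum>b\<in>A. \<bar>c b\<bar> * \<theta>)"
        using \<Psi>(2) by (intro sum_mono mult_left_mono) (auto intro: less_imp_le)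
      also have "\<dots> = \<theta> * (\<Sum>b\<in>A. \<bar>c b\<bar>)" by (simp add: sum_distrib_left mult.commute)
      also have "\<dots> \<le> \<theta> * (C * dual_norm M p y)"
        unfolding y using C(2) \<theta> by (intro mult_left_mono) auto
      also have "\<dots> \<le> \<eta> * dual_norm M p y"
        using mult_right_mono[OF \<theta>(2) dual_norm_nonneg[OF yL]] by (simp add: mult.assoc)
      finally show ?thesis .
    qed
    ultimately show "\<exists>\<psi>\<in>span (point_eval M p ` N). dual_norm M p (y - \<psi>) \<le> \<eta> * dual_norm M p y"
      by blast
  qed
qed

lemma octahedral_free_space:
  assumes ltp: "long_trapezoid_property M" and p: "p \<in> M"
  shows "octahedral (free_space M p) (dual_norm M p)"
  unfolding octahedral_def
proof (intro allI impI, elim conjE exE)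
  fix F B and \<epsilon> :: real
  assume B: "finite B" "F = span B" and F: "F \<subseteq> free_space M p" and \<epsilon>: "\<epsilon> > 0"
  \<comment> \<open>The coefficient of the norm of \<open>y\<close> drops by at most
    \<open>3 * \<theta>\<close>: for approximating \<open>y\<close> by \<open>\<psi>\<close>, for
    the trapezoid factor, and for returning from \<open>\<psi>\<close> to \<open>y\<close>. The
    minimum with \<open>1\<close> keeps \<open>\<theta>\<close> below \<open>1\<close>.\<close>
  define \<theta> where "\<theta> = min \<epsilon> 1 / 4"
  have \<theta>: "\<theta> > 0" "\<theta> < 1" "4 * \<theta> \<le> \<epsilon>" using \<epsilon> by (auto simp: \<theta>_def)
  obtain N where N: "finite N" "N \<subseteq> M" "p \<in> N"
    and approx: "\<And>y. y \<in> F \<Longrightarrow> \<exists>\<psi> \<in> span (point_eval M p ` N).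
      dual_norm M p (y - \<psi>) \<le> \<theta> * dual_norm M p y"
    using finite_dim_approximation_by_finite_support[OF p B(1) F[unfolded B(2)] \<theta>(1)]
    unfolding B(2) by blast
  obtain u v where uv: "u \<in> M" "v \<in> M" "u \<noteq> v" and
    uv_ltp: "\<And>x y. x \<in> N \<Longrightarrow> y \<in> N \<Longrightarrow>
      (1 - \<theta>) * (dist x y + dist u v) \<le> dist x u + dist y v"
    using ltp N \<theta> unfolding long_trapezoid_property_def by meson
  let ?m = "molecule M p u v" and ?n = "dual_norm M p"
  have mL: "?m \<in> Lip0_dual M p" using uv p by (intro molecule_in_Lip0_dual)
  \<comment> \<open>The molecule is itself a combination of evaluations, so it serves as its own
    approximation in the definition of the free space.\<close>
  have "?n (?m - ?m) \<le> 0" by (rule dual_norm_le) simp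
  then have "\<forall>e>0. \<exists>\<psi>\<in>span (point_eval M p ` M). ?n (?m - \<psi>) < e"
    using molecule_in_span[OF uv(1,2)] by (meson order_le_less_trans)
  then have "?m \<in> free_space M p" using mL by (simp add: free_space_def)
  moreover have "(1 - \<epsilon>) * (?n y + \<bar>c\<bar>) \<le> ?n (y + c *\<^sub>R ?m)" if y: "y \<in> F" for y c
  proof -
    obtain \<psi> where \<psi>: "\<psi> \<in> span (point_eval M p ` N)" "?n (y - \<psi>) \<le> \<theta> * ?n y"
      using approx[OF y] by blast
    have yL: "y \<in> Lip0_dual M p" using y F by (auto simp: free_space_def)
    have \<psi>L: "\<psi> \<in> Lip0_dual M p" using span_point_eval_subset_Lip0_dual N(2) p \<psi>(1) by blast
    have dL: "y - \<psi> \<in> Lip0_dual M p" "\<psi> - y \<in> Lip0_dual M p" "y + c *\<^sub>R ?m \<in> Lip0_dual M p"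
      using yL \<psi>L mL subspace_Lip0_dual
      by (auto intro!: subspace_diff subspace_add subspace_scale)
    have swap: "?n (\<psi> - y) = ?n (y - \<psi>)" using dual_norm_uminus[OF dL(1)] by simp
    have "?n y \<le> ?n (y - \<psi>) + ?n \<psi>" using dual_norm_triangle[OF dL(1) \<psi>L] by simp
    then have "(1 - \<theta>) * ((1 - \<theta>) * ?n y + \<bar>c\<bar>) \<le> (1 - \<theta>) * (?n \<psi> + \<bar>c\<bar>)"
      using \<theta> \<psi>(2) by (intro mult_left_mono) (auto simp: left_diff_distrib)
    also have "\<dots> \<le> ?n (\<psi> + c *\<^sub>R ?m)"
      using dual_norm_add_molecule_ge[OF N uv _ \<theta>(2) uv_ltp \<psi>(1)] \<theta> by simp
    also have "\<dots> = ?n ((y + c *\<^sub>R ?m) + (\<psi> - y))"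
      by (rule arg_cong[where f = ?n]) (simp only: algebra_simps diff_add_cancel add_diff_cancel)
    also have "\<dots> \<le> ?n (y + c *\<^sub>R ?m) + \<theta> * ?n y"
      using dual_norm_triangle[OF dL(3,2)] \<psi>(2) swap by linarith
    finally have "(1 - \<theta>) * ((1 - \<theta>) * ?n y + \<bar>c\<bar>) - \<theta> * ?n y \<le> ?n (y + c *\<^sub>R ?m)" by simp
    moreover have "(1 - \<theta>) * ((1 - \<theta>) * ?n y + \<bar>c\<bar>) - \<theta> * ?n y
        = (1 - 3 * \<theta>) * ?n y + \<theta> * \<theta> * ?n y + (1 - \<theta>) * \<bar>c\<bar>" by algebra
    moreover have "(1 - \<epsilon>) * ?n y \<le> (1 - 3 * \<theta>) * ?n y"
      using \<theta> dual_norm_nonneg[OF yL] by (intro mult_right_mono) auto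
    moreover have "(1 - \<epsilon>) * \<bar>c\<bar> \<le> (1 - \<theta>) * \<bar>c\<bar>"
      using \<theta> by (intro mult_right_mono) auto
    moreover have "0 \<le> \<theta> * \<theta> * ?n y" using \<theta> dual_norm_nonneg[OF yL] by simp
    ultimately show ?thesis by (simp only: distrib_left)
  qed
  ultimately show "\<exists>z\<in>free_space M p. ?n z = 1 \<and>
      (\<forall>y\<in>F. \<forall>c. (1 - \<epsilon>) * (?n y + \<bar>c\<bar>) \<le> ?n (y + c *\<^sub>R z))"
    using dual_norm_molecule[OF uv(1,2) p uv(3)] by blast
qed

theorem proposition4p7:
  assumes "AUC TYPE('a::banach)"
    and "\<And>t. t \<ge> 0 \<Longrightarrow> auc_modulus TYPE('a) t = ereal t"
  shows "(\<forall>M::'a set. infinite M \<longrightarrow> long_trapezoid_property M) \<and>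
    (\<forall>M::'a set. infinite M \<longrightarrow>
      (\<forall>p\<in>M. octahedral (free_space M p) (dual_norm M p)))"
  using long_trapezoid_property_of_modulus[OF assms(2)] octahedral_free_space by blast

end
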